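(* Let $k\ge 3$. If $G$ is a class-proper interval $k$-graph, then $G$ is a cocomparability graph.
   Context: All graphs are finite and simple. A graph $G$ is an interval $k$-graph if there is a one-to-one correspondence $v\mapsto I_v$ between $V(G)$ and a family of closed intervals of the real line, together with a partition of the family into at most $k$ classes, such that distinct vertices $u,v$ are adjacent if and only if $I_u\cap I_v\neq\emptyset$ and $I_u,I_v$ lie in different classes. It is a class-proper interval $k$-graph if it has such a representation in which no interval properly contains another interval of the same class. A cocomparability graph is a graph whose complement admits a transitive orientation (equivalently, the incomparability graph of a strict partial order). *)

theory Defs
  imports Complex_Main "HOL-Library.Disjoint_Sets" "Graph_Theory.Graph_Theory"
begin

(* Finite simple graphs are the library's pair_graph: a finite, loop-free, symmetric set of
   arcs. Every undirected edge uv is present as both (u, v) and (v, u). *)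

definition closed_interval :: "real set \<Rightarrow> bool" where
  "closed_interval X \<longleftrightarrow> (\<exists>a b. a \<le> b \<and> X = {a..b})"

(* F is the family of intervals, I the correspondence v \<mapsto> I v, and P the partition of F
   into classes. The number of classes is at most k, not exactly k. Reading the one-to-one
   correspondence as a bijection onto a set F does not restrict the graphs represented:
   with finitely many vertices, coinciding intervals can be enlarged and shifted slightly to
   become distinct, without changing intersections or introducing containments within a class. *)
definition interval_k_representation ::
  "nat \<Rightarrow> 'a pair_pre_digraph \<Rightarrow> real set set \<Rightarrow> ('a \<Rightarrow> real set) \<Rightarrow> real set set set \<Rightarrow> bool" where
  "interval_k_representation k G F I P \<longleftrightarrow>
     (\<forall>X\<in>F. closed_interval X) \<and>
     bij_betw I (pverts G) F \<and>
     partition_on F P \<and> finite P \<and> card P \<le> k \<and>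
     (\<forall>u\<in>pverts G. \<forall>v\<in>pverts G. u \<noteq> v \<longrightarrow>
        ((u, v) \<in> parcs G \<longleftrightarrow> I u \<inter> I v \<noteq> {} \<and> \<not> (\<exists>C\<in>P. I u \<in> C \<and> I v \<in> C)))"

definition interval_k_graph :: "nat \<Rightarrow> 'a pair_pre_digraph \<Rightarrow> bool" where
  "interval_k_graph k G \<longleftrightarrow> pair_graph G \<and> (\<exists>F I P. interval_k_representation k G F I P)"

definition class_proper_interval_k_graph :: "nat \<Rightarrow> 'a pair_pre_digraph \<Rightarrow> bool" where
  "class_proper_interval_k_graph k G \<longleftrightarrow> pair_graph G \<and>
     (\<exists>F I P. interval_k_representation k G F I P \<and> (\<forall>C\<in>P. \<forall>X\<in>C. \<forall>Y\<in>C. \<not> X \<subset> Y))"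

definition graph_complement :: "'a pair_pre_digraph \<Rightarrow> 'a pair_pre_digraph" where
  "graph_complement G =
     \<lparr> pverts = pverts G,
       parcs = {(u, v). u \<in> pverts G \<and> v \<in> pverts G \<and> u \<noteq> v \<and> (u, v) \<notin> parcs G} \<rparr>"

(* R selects exactly one of the two arcs of every edge. *)
definition orientation :: "'a pair_pre_digraph \<Rightarrow> 'a rel \<Rightarrow> bool" where
  "orientation G R \<longleftrightarrow> R \<union> R\<inverse> = parcs G \<and> R \<inter> R\<inverse> = {}"

definition cocomparability_graph :: "'a pair_pre_digraph \<Rightarrow> bool" where
  "cocomparability_graph G \<longleftrightarrow>
     pair_graph G \<and> (\<exists>R. orientation (graph_complement G) R \<and> trans R)"

end

(* Order nonadjacent vertices by the left endpoints of their intervals. If u < v < w in this order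
   and the intervals of u and w intersect, then the interval of v meets both of them, so
   nonadjacency forces u, v, w into one class, and u, w are nonadjacent after all. *)

theory Submission
  imports Defs
begin

text \<open>Of the two arcs of an edge, exactly one increases the key. The key only has to separate
  ends of arcs: left endpoints may coincide for vertices that are not joined in the
  complement.\<close>

lemma orientation_by_injective_key:
  fixes f :: "'a \<Rightarrow> real"
  assumes "sym (parcs H)" and "\<And>u v. (u, v) \<in> parcs H \<Longrightarrow> f u \<noteq> f v"
  shows "orientation H {(u, v) \<in> parcs H. f u < f v}"
proof -
  let ?R = "{(u, v) \<in> parcs H. f u < f v}"
  have "(u, v) \<in> ?R \<union> ?R\<inverse> \<longleftrightarrow> (u, v) \<in> parcs H" for u v
    using assms(1)[THEN symD] assms(2)[of u v] by (auto simp: neq_iff)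
  moreover have "?R \<inter> ?R\<inverse> = {}"
    by auto
  ultimately show ?thesis
    unfolding orientation_def by (intro conjI set_eqI) auto
qed

theorem theorem4p1:
  fixes G :: "'a pair_pre_digraph" and k :: nat
  assumes "k \<ge> 3" and "class_proper_interval_k_graph k G"
  shows "cocomparability_graph G"
proof -
  obtain F I P where pg: "pair_graph G" and rep: "interval_k_representation k G F I P"
    and proper: "\<forall>C\<in>P. \<forall>X\<in>C. \<forall>Y\<in>C. \<not> X \<subset> Y"
    using assms(2) unfolding class_proper_interval_k_graph_def by (elim conjE exE)
  define V where "V = pverts G"
  define same where "same u v \<longleftrightarrow> (\<exists>C\<in>P. I u \<in> C \<and> I v \<in> C)" for u v
  have inj: "inj_on I V" and F: "I ` V = F"
    using rep unfolding interval_k_representation_def bij_betw_def V_def by auto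
  have adj: "(u, v) \<in> parcs G \<longleftrightarrow> I u \<inter> I v \<noteq> {} \<and> \<not> same u v"
    if "u \<in> V" "v \<in> V" "u \<noteq> v" for u v
    using rep that unfolding interval_k_representation_def same_def V_def by simp
  have "\<forall>u\<in>V. \<exists>a b. a \<le> b \<and> I u = {a..b}"
  proof
    fix u assume "u \<in> V"
    then have "closed_interval (I u)"
      using rep F unfolding interval_k_representation_def by auto
    then show "\<exists>a b. a \<le> b \<and> I u = {a..b}"
      unfolding closed_interval_def .
  qed
  then obtain l r where lr: "\<And>u. u \<in> V \<Longrightarrow> l u \<le> r u" "\<And>u. u \<in> V \<Longrightarrow> I u = {l u..r u}"
    by metis
  have same_trans: "same u w" if uv: "same u v" and vw: "same v w" for u v w
  proof -
    have "disjoint P"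
      using rep unfolding interval_k_representation_def partition_on_def by simp
    moreover obtain C D where "C \<in> P" "I u \<in> C" "I v \<in> C" "D \<in> P" "I v \<in> D" "I w \<in> D"
      using uv vw unfolding same_def by blast
    ultimately have "C = D"
      unfolding disjoint_def by blast
    with \<open>C \<in> P\<close> \<open>I u \<in> C\<close> \<open>I w \<in> D\<close> show ?thesis
      unfolding same_def by blast
  qed
  have same_sym: "same u v \<longleftrightarrow> same v u" for u v
    unfolding same_def by blast
  \<comment> \<open>Intervals with a common left endpoint are nested. As \<open>I\<close> is
    injective the nesting is strict, which class-properness excludes.\<close>
  have same_neq: "l u \<noteq> l v" if "u \<in> V" "v \<in> V" "u \<noteq> v" "same u v" for u v
  proof
    assume "l u = l v"
    then have "I u \<subseteq> I v \<or> I v \<subseteq> I u"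
      using that lr by auto
    moreover have "I u \<noteq> I v"
      using inj that by (auto dest: inj_onD)
    ultimately have "I u \<subset> I v \<or> I v \<subset> I u"
      by auto
    then show False
      using that(4) proper unfolding same_def by metis
  qed
  have same_less: "r u < r v" if "u \<in> V" "v \<in> V" "same u v" "l u < l v" for u v
  proof (rule ccontr)
    assume "\<not> r u < r v"
    \<comment> \<open>The containment is strict because the point \<open>l u\<close> of
      \<open>I u\<close> lies to the left of \<open>I v\<close>.\<close>
    then have "I v \<subset> I u"
      using that lr by (auto simp: psubset_eq)
    then show False
      using that(3) proper unfolding same_def by metis
  qed
  define H where "H = graph_complement G"
  have H: "(u, v) \<in> parcs H \<longleftrightarrow> u \<in> V \<and> v \<in> V \<and> u \<noteq> v \<and> (same u v \<or> I u \<inter> I v = {})" for u v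
    using adj[of u v] unfolding H_def graph_complement_def V_def by auto
  have "sym (parcs H)"
    unfolding sym_def H using same_sym by (auto simp: Int_commute)
  \<comment> \<open>If \<open>u\<close> and \<open>v\<close> are not in one class, their intervals
    are disjoint, and a shared left endpoint would be a common point.\<close>
  moreover have "l u \<noteq> l v" if "(u, v) \<in> parcs H" for u v
    using that same_neq[of u v] lr[of u] lr[of v] unfolding H by auto
  ultimately have ori: "orientation H {(u, v) \<in> parcs H. l u < l v}"
    by (rule orientation_by_injective_key)
  \<comment> \<open>The bound on right endpoints serves transitivity: it carries a gap between
    \<open>v\<close> and \<open>w\<close> back to \<open>u\<close>.\<close>
  have before: "r u < r v" "same u v \<or> r u < l v" if "(u, v) \<in> parcs H" "l u < l v" for u v
  proof -
    from that have V: "u \<in> V" "v \<in> V" and nadj: "same u v \<or> I u \<inter> I v = {}"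
      unfolding H by auto
    have "r u < l v" if "I u \<inter> I v = {}"
    proof (rule ccontr)
      assume "\<not> r u < l v"
      then have "l v \<in> I u \<inter> I v"
        using V lr \<open>l u < l v\<close> by auto
      with that show False by blast
    qed
    with nadj show "same u v \<or> r u < l v" by blast
    then show "r u < r v"
      using same_less[OF V _ that(2)] lr(1)[OF V(2)] by auto
  qed
  have "trans {(u, v) \<in> parcs H. l u < l v}"
  proof (rule transI, clarify)
    fix u v w
    assume uv: "(u, v) \<in> parcs H" "l u < l v" and vw: "(v, w) \<in> parcs H" "l v < l w"
    have "same u w \<or> r u < l w"
      using before(2)[OF uv] before(2)[OF vw]
    proof (elim disjE)
      assume "same u v" "same v w"
      then show ?thesis using same_trans by blast
    \<comment> \<open>In the remaining cases a gap exists: \<open>r u < l v < l w\<close> if it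
      follows \<open>u\<close>, and \<open>r u < r v < l w\<close> if it follows
      \<open>v\<close>.\<close>
    qed (use before(1)[OF uv] vw(2) in auto)
    then have "same u w \<or> I u \<inter> I w = {}"
      using uv(1) vw(1) lr unfolding H by auto
    \<comment> \<open>That \<open>u\<close> and \<open>w\<close> are distinct, as an arc of
      \<open>H\<close> requires, comes from \<open>l u < l v < l w\<close>.\<close>
    then show "(u, w) \<in> parcs H \<and> l u < l w"
      using uv vw unfolding H by auto
  qed
  with ori pg show ?thesis
    unfolding cocomparability_graph_def H_def by (intro conjI exI)
qed

end
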